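(* Let $d\ge 2$, $n\ge1$ and $1\le\rho\le n$ be integers. Let $\mathbb{L}/\mathbb{F}$ be a cyclic Galois extension of fields of degree $n$, let $\sigma$ be a generator of $\mathrm{Gal}(\mathbb{L}/\mathbb{F})$ and let $\alpha\in\mathbb{L}^n$ be an $\mathbb{F}$-basis of $\mathbb{L}$. Then $$\dim_{\mathbb{F}}\mathcal{C}_{\rho}^{n,d}(\alpha)\geq\binom{n+d-1}{d}-n\binom{d+\rho-3}{d-1}.$$
   Context: For a field $K$, let $S_{n,d}(K)=K[x_1,\ldots,x_n]_d$ be the space of homogeneous polynomials of degree $d$ (including $0$), and $T_{n,d}(K)=K[\partial_1,\ldots,\partial_n]_d$ the space of homogeneous differential operators of degree $d$ (including $0$), acting on polynomials by $\partial_i\circ f=\partial f/\partial x_i$. For $v\in K^n$ write $v(\partial)=v_1\partial_1+\ldots+v_n\partial_n$. A vector $\alpha=(\alpha_1,\ldots,\alpha_n)\in\mathbb{L}^n$ is called an $\mathbb{F}$-basis of $\mathbb{L}$ if its entries form one; $\sigma$ acts on $\mathbb{L}^n$ entrywise. For $B\subseteq T_{n,d}(\mathbb{L})$ let $B^\perp=\{f\in S_{n,d}(\mathbb{L})\mid D\circ f=0\text{ for all }D\in B\}$. Define the $\mathbb{F}$-vector space $$\mathcal{C}_{\rho}^{n,d}(\alpha)=\left\{\alpha(\partial)\prod_{j=2}^d\sigma^{r_j}(\alpha)(\partial)\;\middle|\;0\le r_2,\ldots,r_d\le\rho-2\right\}^\perp\cap S_{n,d}(\mathbb{F}),$$ where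 the $r_j$ are integers. *)

theory Defs
  imports Complex_Main "HOL-Library.Poly_Mapping" "HOL-Algebra.Generated_Groups"
begin

section \<open>Field extensions\<close>

text \<open>A field extension is given by its embedding \<open>\<iota>\<close> of the base field into the extension
  field; the base field, seen as a subfield of the extension, is \<open>range \<iota>\<close>.\<close>

definition field_hom :: "('a::field \<Rightarrow> 'b::field) \<Rightarrow> bool" where
  "field_hom \<phi> \<longleftrightarrow> \<phi> 1 = 1 \<and> (\<forall>x y. \<phi> (x + y) = \<phi> x + \<phi> y) \<and> (\<forall>x y. \<phi> (x * y) = \<phi> x * \<phi> y)"

definition ext_scale :: "('f::field \<Rightarrow> 'l::field) \<Rightarrow> 'f \<Rightarrow> 'l \<Rightarrow> 'l" where
  "ext_scale \<iota> a x = \<iota> a * x"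

lemma vector_space_ext_scale:
  assumes "field_hom \<iota>" shows "vector_space (ext_scale \<iota>)"
  using assms by unfold_locales (auto simp: field_hom_def ext_scale_def algebra_simps)

definition ext_degree :: "('f::field \<Rightarrow> 'l::field) \<Rightarrow> nat" where
  "ext_degree \<iota> = vector_space.dim (ext_scale \<iota>) UNIV"

definition finite_extension :: "('f::field \<Rightarrow> 'l::field) \<Rightarrow> bool" where
  "finite_extension \<iota> \<longleftrightarrow> field_hom \<iota> \<and> (\<exists>B. finite B \<and> module.span (ext_scale \<iota>) B = UNIV)"

definition Gal :: "('f::field \<Rightarrow> 'l::field) \<Rightarrow> ('l \<Rightarrow> 'l) monoid" where
  "Gal \<iota> = \<lparr>carrier = {\<tau>. field_hom \<tau> \<and> bij \<tau> \<and> (\<forall>a. \<tau> (\<iota> a) = \<iota> a)}, mult = (\<circ>), one = id\<rparr>"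

lemma group_Gal: "group (Gal \<iota>)"
proof (rule groupI)
  fix \<tau> assume "\<tau> \<in> carrier (Gal \<iota>)"
  then have h: "field_hom \<tau>" "bij \<tau>" "\<And>a. \<tau> (\<iota> a) = \<iota> a" by (auto simp: Gal_def)
  define \<upsilon> where "\<upsilon> = Hilbert_Choice.inv \<tau>"
  have u: "\<tau> (\<upsilon> x) = x" "\<upsilon> (\<tau> x) = x" for x
    using h(2) by (auto simp: \<upsilon>_def bij_is_surj surj_f_inv_f bij_is_inj)
  have eq: "\<upsilon> y = x" if "y = \<tau> x" for x y using that u by simp
  have "field_hom \<upsilon>"
    unfolding field_hom_def using h(1) by (auto simp: field_hom_def u intro!: eq)
  moreover have "bij \<upsilon>" using h(2) by (simp add: \<upsilon>_def bij_imp_bij_inv)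
  moreover have "\<upsilon> (\<iota> a) = \<iota> a" for a using h(3) by (auto intro!: eq)
  ultimately show "\<exists>\<upsilon>\<in>carrier (Gal \<iota>). \<upsilon> \<otimes>\<^bsub>Gal \<iota>\<^esub> \<tau> = \<one>\<^bsub>Gal \<iota>\<^esub>"
    by (intro bexI[of _ \<upsilon>]) (auto simp: Gal_def fun_eq_iff u)
qed (auto simp: Gal_def field_hom_def o_assoc bij_comp)

definition galois_extension :: "('f::field \<Rightarrow> 'l::field) \<Rightarrow> bool" where
  "galois_extension \<iota> \<longleftrightarrow>
     finite_extension \<iota> \<and> {x. \<forall>\<tau>\<in>carrier (Gal \<iota>). \<tau> x = x} = range \<iota>"

text \<open>Vectors of length \<open>n\<close> are functions on \<open>nat\<close>, of which only the values on \<open>{1..n}\<close> matter.\<close>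

definition ext_basis :: "('f::field \<Rightarrow> 'l::field) \<Rightarrow> nat \<Rightarrow> (nat \<Rightarrow> 'l) \<Rightarrow> bool" where
  "ext_basis \<iota> n \<alpha> \<longleftrightarrow> inj_on \<alpha> {1..n}
     \<and> \<not> module.dependent (ext_scale \<iota>) (\<alpha> ` {1..n})
     \<and> module.span (ext_scale \<iota>) (\<alpha> ` {1..n}) = UNIV"

section \<open>Polynomials and differential operators\<close>

text \<open>The type \<open>'a mpoly\<close> serves both for polynomials in \<open>x\<^sub>1, x\<^sub>2, \<dots>\<close> and for polynomials in the
  symbols \<open>\<partial>\<^sub>1, \<partial>\<^sub>2, \<dots>\<close>: a monomial is its exponent vector \<open>nat \<Rightarrow>\<^sub>0 nat\<close>, and multiplication is the
  library's convolution product.\<close>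

type_synonym 'a mpoly = "(nat \<Rightarrow>\<^sub>0 nat) \<Rightarrow>\<^sub>0 'a"

definition const_poly :: "'a::comm_ring_1 \<Rightarrow> 'a mpoly" where
  "const_poly c = Poly_Mapping.single 0 c"

definition hom_polys :: "nat \<Rightarrow> nat \<Rightarrow> 'a::comm_ring_1 set \<Rightarrow> 'a mpoly set" where
  "hom_polys n d K = {f. (\<forall>m\<in>Poly_Mapping.keys f. Poly_Mapping.keys m \<subseteq> {1..n}
                             \<and> (\<Sum>i=1..n. Poly_Mapping.lookup m i) = d)
                       \<and> (\<forall>m. Poly_Mapping.lookup f m \<in> K)}"

text \<open>Subtraction of exponents is truncated, but the terms affected have coefficient \<open>0\<close>.\<close>

definition pdiff :: "nat \<Rightarrow> 'a::comm_ring_1 mpoly \<Rightarrow> 'a mpoly" where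
  "pdiff i f = (\<Sum>m\<in>Poly_Mapping.keys f.
     Poly_Mapping.single (m - Poly_Mapping.single i 1)
       (of_nat (Poly_Mapping.lookup m i) * Poly_Mapping.lookup f m))"

text \<open>Action of a monomial \<open>\<partial>\<^sup>m\<close>. The order in which the (commuting) partial derivatives
  are composed is immaterial; fixing it makes this a definition.\<close>

definition monom_act :: "(nat \<Rightarrow>\<^sub>0 nat) \<Rightarrow> 'a::comm_ring_1 mpoly \<Rightarrow> 'a mpoly" where
  "monom_act m f =
     foldr (\<lambda>i. pdiff i ^^ Poly_Mapping.lookup m i) (sorted_list_of_set (Poly_Mapping.keys m)) f"

definition diff_act :: "'a::comm_ring_1 mpoly \<Rightarrow> 'a mpoly \<Rightarrow> 'a mpoly" where
  "diff_act D f = (\<Sum>m\<in>Poly_Mapping.keys D. const_poly (Poly_Mapping.lookup D m) * monom_act m f)"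

definition dir_op :: "nat \<Rightarrow> (nat \<Rightarrow> 'a::comm_ring_1) \<Rightarrow> 'a mpoly" where
  "dir_op n v = (\<Sum>i=1..n. const_poly (v i) * Poly_Mapping.single (Poly_Mapping.single i 1) 1)"

definition perp :: "nat \<Rightarrow> nat \<Rightarrow> 'a::comm_ring_1 mpoly set \<Rightarrow> 'a mpoly set" where
  "perp n d B = {f \<in> hom_polys n d UNIV. \<forall>D\<in>B. diff_act D f = 0}"

definition poly_scale :: "('f::field \<Rightarrow> 'l::field) \<Rightarrow> 'f \<Rightarrow> 'l mpoly \<Rightarrow> 'l mpoly" where
  "poly_scale \<iota> a f = const_poly (\<iota> a) * f"

lemma vector_space_poly_scale:
  assumes "field_hom \<iota>" shows "vector_space (poly_scale \<iota>)"
proof -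
  have "const_poly (x * y) = const_poly x * const_poly y" for x y :: 'b
    by (simp add: const_poly_def Poly_Mapping.mult_single)
  with assms show ?thesis
    by unfold_locales
      (auto simp: field_hom_def poly_scale_def const_poly_def single_add algebra_simps)
qed

section \<open>The space \<open>\<C>\<^sub>\<rho>\<close>\<close>

text \<open>The bound \<open>r j \<le> \<rho> - 2\<close> is stated over the integers, so that for \<open>\<rho> = 1\<close> no \<open>r\<close> is admissible
  and the set of operators is empty.\<close>

definition code_space ::
  "('f::field \<Rightarrow> 'l::field) \<Rightarrow> ('l \<Rightarrow> 'l) \<Rightarrow> nat \<Rightarrow> nat \<Rightarrow> nat \<Rightarrow> (nat \<Rightarrow> 'l) \<Rightarrow> 'l mpoly set" where
  "code_space \<iota> \<sigma> n d \<rho> \<alpha> =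
     perp n d {dir_op n \<alpha> * (\<Prod>j=2..d. dir_op n (\<lambda>i. (\<sigma> ^^ r j) (\<alpha> i))) | r :: nat \<Rightarrow> nat.
                 \<forall>j\<in>{2..d}. int (r j) \<le> int \<rho> - 2}
     \<inter> hom_polys n d (range \<iota>)"

end

theory Submission
  imports Defs
begin

text \<open>Each operator has degree \<open>d\<close>, so it maps a form of degree \<open>d\<close> over F to a constant in
  L; as L has dimension \<open>n\<close> over F, its vanishing amounts to \<open>n\<close> linear conditions over
  F. Since the operators commute, only the multiset of the exponents \<open>r\<^sub>2, \<dots>, r\<^sub>d\<close> matters, and
  there are \<open>(d + \<rho> - 3) choose (d - 1)\<close> multisets of size \<open>d - 1\<close> in a set of \<open>\<rho> - 1\<close> elements.\<close>

section \<open>Linear functionals and the codimension of their common kernel\<close>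

context vector_space
begin

text \<open>If \<open>\<phi> w\<close> is nonzero for some \<open>w\<close> in \<open>W\<close>,
  every element of \<open>W\<close> differs from a multiple of \<open>w\<close> by an element of the
  kernel, so \<open>w\<close> together with a basis of the kernel spans \<open>W\<close>. The finite
  set \<open>T\<close> bounds the size of independent subsets of \<open>W\<close>, which makes that
  basis finite.\<close>

lemma dim_le_Suc_dim_kernel:
  assumes W: "subspace W" and T: "W \<subseteq> span T" "finite T"
    and \<phi>: "Vector_Spaces.linear scale (*) \<phi>"
  shows "dim W \<le> Suc (dim {x \<in> W. \<phi> x = 0})"
proof -
  interpret \<phi>: Vector_Spaces.linear scale "(*)" \<phi> by (fact \<phi>)
  let ?K = "{x \<in> W. \<phi> x = 0}"
  obtain B where B: "B \<subseteq> ?K" "independent B" "?K \<subseteq> span B" "card B = dim ?K"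
    using basis_exists by blast
  have fB: "finite B"
    using independent_span_bound[OF T(2) B(2)] B(1) T(1) by blast
  show ?thesis
  proof (cases "\<forall>x\<in>W. \<phi> x = 0")
    case True
    then have "?K = W" by auto
    then show ?thesis by simp
  next
    case False
    then obtain w where w: "w \<in> W" "\<phi> w \<noteq> 0" by auto
    have "W \<subseteq> span (insert w B)"
    proof
      fix x assume x: "x \<in> W"
      \<comment> \<open>With this scalar, \<open>\<phi>\<close> vanishes on
        \<open>x - scale c w\<close>.\<close>
      define c where "c = \<phi> x / \<phi> w"
      have "x - scale c w \<in> ?K"
        using x w W by (auto simp: c_def \<phi>.diff \<phi>.scale intro: subspace_diff subspace_scale)
      then have "x - scale c w \<in> span B" using B(3) by blast
      then show "x \<in> span (insert w B)" by (auto simp: span_insert)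
    qed
    then have "dim W \<le> card (insert w B)" using fB by (intro dim_le_card) auto
    also have "\<dots> \<le> Suc (card B)" by (simp add: card_insert_le_m1 fB card_insert_if)
    finally show ?thesis using B(4) by simp
  qed
qed

text \<open>The conditions are imposed one at a time, and each costs at most one dimension.\<close>

lemma dim_le_dim_kernels_add_card:
  assumes V: "subspace V" and T: "V \<subseteq> span T" "finite T"
    and "finite J" and "\<And>j. j \<in> J \<Longrightarrow> Vector_Spaces.linear scale (*) (\<phi> j)"
  shows "dim V \<le> dim {x \<in> V. \<forall>j\<in>J. \<phi> j x = 0} + card J"
  using \<open>finite J\<close> assms(5)
proof (induction J rule: finite_induct)
  case empty
  then show ?case by simp
next
  case (insert j J)
  let ?W = "{x \<in> V. \<forall>j\<in>J. \<phi> j x = 0}"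
  \<comment> \<open>The next functional is restricted to the common kernel of the earlier ones, so
    the one-functional bound requires this kernel to be a subspace.\<close>
  have "subspace ?W"
  proof -
    have "\<phi> i 0 = 0" "\<phi> i (x + y) = \<phi> i x + \<phi> i y" "\<phi> i (scale c x) = c * \<phi> i x"
      if "i \<in> J" for i x y c
    proof -
      interpret \<phi>: Vector_Spaces.linear scale "(*)" "\<phi> i" using insert.prems that by blast
      show "\<phi> i 0 = 0" "\<phi> i (x + y) = \<phi> i x + \<phi> i y" "\<phi> i (scale c x) = c * \<phi> i x"
        by (simp_all add: \<phi>.zero \<phi>.add \<phi>.scale)
    qed
    then show ?thesis using V by (auto simp: subspace_def)
  qed
  then have "dim ?W \<le> Suc (dim {x \<in> ?W. \<phi> j x = 0})"
    using T insert.prems by (intro dim_le_Suc_dim_kernel[of _ T]) auto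
  moreover have "{x \<in> ?W. \<phi> j x = 0} = {x \<in> V. \<forall>j\<in>insert j J. \<phi> j x = 0}" by auto
  moreover have "dim V \<le> dim ?W + card J" using insert by auto
  ultimately show ?case using insert.hyps by simp
qed

end

section \<open>Linearity of the action of differential operators\<close>

lemma lookup_const_poly_mult [simp]:
  "Poly_Mapping.lookup (const_poly c * f) m = c * Poly_Mapping.lookup f m"
  by (simp add: const_poly_def mult_map_scale_conv_mult[symmetric] map.rep_eq when_def)

text \<open>Only the monomial with exponent \<open>m + Poly_Mapping.single i 1\<close>
  differentiates to one with exponent \<open>m\<close>. Linearity of \<open>pdiff\<close> and its
  effect on degrees are read off from this formula.\<close>

lemma lookup_pdiff:
  "Poly_Mapping.lookup (pdiff i f) m
     = of_nat (Poly_Mapping.lookup m i + 1) * Poly_Mapping.lookup f (m + Poly_Mapping.single i 1)"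
proof -
  let ?t = "\<lambda>k. of_nat (Poly_Mapping.lookup k i) * Poly_Mapping.lookup f k"
  let ?m = "m + Poly_Mapping.single i 1"
  \<comment> \<open>Truncated subtraction leaves exponents without \<open>i\<close> unchanged, but
    for those \<open>?t k\<close> is zero; for all others the subtraction can be undone.\<close>
  have "(?t k when k - Poly_Mapping.single i 1 = m) = (?t k when k = ?m)" for k
  proof (cases "Poly_Mapping.lookup k i = 0")
    case True
    then show ?thesis by (auto simp: when_def lookup_add)
  next
    case False
    then have "k - Poly_Mapping.single i 1 + Poly_Mapping.single i 1 = k"
      by (intro poly_mapping_eqI) (auto simp: lookup_add lookup_minus lookup_single when_def)
    then show ?thesis by (auto simp: when_def)
  qed
  then have "Poly_Mapping.lookup (pdiff i f) m
      = (\<Sum>k\<in>Poly_Mapping.keys f. ?t k when k = ?m)"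
    by (simp add: pdiff_def lookup_sum lookup_single)
  also have "\<dots> = ?t ?m"
    by (simp add: when_def sum.delta in_keys_iff)
  finally show ?thesis by (simp add: lookup_add)
qed

lemma pdiff_add: "pdiff i (f + g) = pdiff i f + pdiff i g"
  by (intro poly_mapping_eqI) (simp add: lookup_pdiff lookup_add algebra_simps)

lemma pdiff_const_poly_mult: "pdiff i (const_poly c * f) = const_poly c * pdiff i f"
  by (intro poly_mapping_eqI) (simp add: lookup_pdiff mult.left_commute)

lemma pdiff_funpow_add: "(pdiff i ^^ k) (f + g) = (pdiff i ^^ k) f + (pdiff i ^^ k) g"
  by (induction k) (auto simp: pdiff_add)

lemma pdiff_funpow_const_poly_mult:
  "(pdiff i ^^ k) (const_poly c * f) = const_poly c * (pdiff i ^^ k) f"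
  by (induction k) (auto simp: pdiff_const_poly_mult)

lemma monom_act_add: "monom_act m (f + g) = monom_act m f + monom_act m g"
proof -
  have "foldr (\<lambda>i. pdiff i ^^ e i) xs (f + g)
      = foldr (\<lambda>i. pdiff i ^^ e i) xs f + foldr (\<lambda>i. pdiff i ^^ e i) xs g" for e xs
    by (induction xs) (auto simp: pdiff_funpow_add)
  then show ?thesis by (simp add: monom_act_def)
qed

lemma monom_act_const_poly_mult: "monom_act m (const_poly c * f) = const_poly c * monom_act m f"
proof -
  have "foldr (\<lambda>i. pdiff i ^^ e i) xs (const_poly c * f)
      = const_poly c * foldr (\<lambda>i. pdiff i ^^ e i) xs f" for e xs
    by (induction xs) (auto simp: pdiff_funpow_const_poly_mult)
  then show ?thesis by (simp add: monom_act_def)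
qed

lemma diff_act_add: "diff_act D (f + g) = diff_act D f + diff_act D g"
  by (simp add: diff_act_def monom_act_add algebra_simps sum.distrib)

lemma diff_act_const_poly_mult: "diff_act D (const_poly c * f) = const_poly c * diff_act D f"
  by (simp add: diff_act_def monom_act_const_poly_mult sum_distrib_left mult.left_commute)

section \<open>Homogeneous forms and the degree of their derivatives\<close>

lemma zero_in_hom_polys: "0 \<in> hom_polys n d UNIV"
  by (simp add: hom_polys_def)

lemma add_in_hom_polys:
  "f \<in> hom_polys n d UNIV \<Longrightarrow> g \<in> hom_polys n d UNIV \<Longrightarrow> f + g \<in> hom_polys n d UNIV"
  using Poly_Mapping.keys_add[of f g] unfolding hom_polys_def by blast

lemma sum_in_hom_polys:
  "(\<And>x. x \<in> A \<Longrightarrow> f x \<in> hom_polys n d UNIV) \<Longrightarrow> sum f A \<in> hom_polys n d UNIV"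
  by (induction A rule: infinite_finite_induct) (auto simp: zero_in_hom_polys add_in_hom_polys)

lemma const_poly_mult_in_hom_polys:
  assumes "f \<in> hom_polys n d UNIV" shows "const_poly c * f \<in> hom_polys n d UNIV"
proof -
  have "Poly_Mapping.keys (const_poly c * f) \<subseteq> Poly_Mapping.keys f"
    by (auto simp: in_keys_iff)
  then show ?thesis using assms by (auto simp: hom_polys_def)
qed

lemma mult_in_hom_polys:
  assumes "f \<in> hom_polys n d UNIV" "g \<in> hom_polys n e UNIV"
  shows "f * g \<in> hom_polys n (d + e) UNIV"
proof -
  have "Poly_Mapping.keys m \<subseteq> {1..n} \<and> (\<Sum>i=1..n. Poly_Mapping.lookup m i) = d + e"
    if m: "m \<in> Poly_Mapping.keys (f * g)" for m
  proof -
    obtain a b where "m = a + b" "a \<in> Poly_Mapping.keys f" "b \<in> Poly_Mapping.keys g"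
      using m Poly_Mapping.keys_mult[of f g] by blast
    moreover have "Poly_Mapping.keys (a + b) \<subseteq> Poly_Mapping.keys a \<union> Poly_Mapping.keys b"
      by (rule Poly_Mapping.keys_add)
    ultimately show ?thesis
      using assms by (auto simp: hom_polys_def lookup_add sum.distrib)
  qed
  then show ?thesis by (simp add: hom_polys_def)
qed

lemma prod_in_hom_polys:
  assumes "finite A" "\<And>x. x \<in> A \<Longrightarrow> f x \<in> hom_polys n 1 UNIV"
  shows "prod f A \<in> hom_polys n (card A) UNIV"
  using assms
proof (induction A rule: finite_induct)
  case empty
  have "Poly_Mapping.keys (1 :: 'b mpoly) = {0}" by (simp add: single_one[symmetric] del: single_one)
  then show ?case by (simp add: hom_polys_def)
next
  case (insert x A)
  then show ?case using mult_in_hom_polys[of "f x" n 1 "prod f A" "card A"] by simp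
qed

lemma dir_op_in_hom_polys: "dir_op n v \<in> hom_polys n 1 UNIV"
  unfolding dir_op_def
  by (intro sum_in_hom_polys const_poly_mult_in_hom_polys)
    (auto simp: hom_polys_def lookup_single when_def)

text \<open>A monomial of the derivative comes from a monomial of \<open>f\<close> whose exponent at
  \<open>i\<close> is larger by one; since \<open>i\<close> lies in \<open>{1..n}\<close>, this
  difference counts in the degree.\<close>

lemma pdiff_in_hom_polys:
  assumes "f \<in> hom_polys n (Suc d) UNIV" "i \<in> {1..n}"
  shows "pdiff i f \<in> hom_polys n d UNIV"
proof -
  have "Poly_Mapping.keys m \<subseteq> {1..n} \<and> (\<Sum>j=1..n. Poly_Mapping.lookup m j) = d"
    if "m \<in> Poly_Mapping.keys (pdiff i f)" for m
  proof -
    let ?m = "m + Poly_Mapping.single i 1"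
    have m: "?m \<in> Poly_Mapping.keys f"
      using that by (auto simp: in_keys_iff lookup_pdiff)
    have "Poly_Mapping.keys m \<subseteq> Poly_Mapping.keys ?m"
      by (auto simp: in_keys_iff lookup_add)
    moreover have "(\<Sum>j=1..n. Poly_Mapping.lookup ?m j) = Suc (\<Sum>j=1..n. Poly_Mapping.lookup m j)"
      using assms(2) by (simp add: lookup_add sum.distrib lookup_single when_def)
    ultimately show ?thesis using assms(1) m by (auto simp: hom_polys_def)
  qed
  then show ?thesis by (simp add: hom_polys_def)
qed

lemma pdiff_funpow_in_hom_polys:
  assumes "i \<in> {1..n}"
  shows "f \<in> hom_polys n (d + k) UNIV \<Longrightarrow> (pdiff i ^^ k) f \<in> hom_polys n d UNIV"
  using assms by (induction k arbitrary: d) (auto intro!: pdiff_in_hom_polys)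

lemma monom_act_in_hom_polys:
  assumes "Poly_Mapping.keys m \<subseteq> {1..n}" "(\<Sum>i=1..n. Poly_Mapping.lookup m i) = k"
    and "f \<in> hom_polys n (d + k) UNIV"
  shows "monom_act m f \<in> hom_polys n d UNIV"
proof -
  \<comment> \<open>Each entry \<open>i\<close> of \<open>xs\<close> lowers the degree by
    \<open>e i\<close>. The tail of the list acts first and leaves a form of higher degree, so
    \<open>d\<close> has to vary in the induction.\<close>
  have *: "foldr (\<lambda>i. pdiff i ^^ e i) xs f \<in> hom_polys n d UNIV"
    if "set xs \<subseteq> {1..n}" "f \<in> hom_polys n (d + sum_list (map e xs)) UNIV" for e xs d
    using that by (induction xs arbitrary: d) (auto intro!: pdiff_funpow_in_hom_polys simp: add.assoc)
  have "sum_list (map (Poly_Mapping.lookup m) (sorted_list_of_set (Poly_Mapping.keys m)))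
      = (\<Sum>i\<in>Poly_Mapping.keys m. Poly_Mapping.lookup m i)"
    by (simp add: sum_list_distinct_conv_sum_set)
  also have "\<dots> = k"
    unfolding assms(2)[symmetric] using assms(1)
    by (intro sum.mono_neutral_left) (auto simp: in_keys_iff)
  finally show ?thesis
    unfolding monom_act_def using assms by (intro *) auto
qed

text \<open>Every monomial of \<open>D\<close> lowers the degree by \<open>k\<close>. In particular,
  for \<open>d = 0\<close>, an operator sends a form of its own degree to a constant.\<close>

lemma diff_act_in_hom_polys:
  assumes "D \<in> hom_polys n k UNIV" "f \<in> hom_polys n (d + k) UNIV"
  shows "diff_act D f \<in> hom_polys n d UNIV"
  unfolding diff_act_def using assms
  by (intro sum_in_hom_polys const_poly_mult_in_hom_polys monom_act_in_hom_polys)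
    (auto simp: hom_polys_def)

text \<open>The only exponent vector of degree 0 is \<open>0\<close>. Vanishing of a form of degree
  0 is thus a condition on a single element of the coefficient ring.\<close>

lemma hom_polys_0_eq_0_iff:
  assumes "f \<in> hom_polys n 0 UNIV"
  shows "f = 0 \<longleftrightarrow> Poly_Mapping.lookup f 0 = 0"
proof
  assume f: "Poly_Mapping.lookup f 0 = 0"
  have "m = 0" if m: "m \<in> Poly_Mapping.keys f" for m
  proof (rule poly_mapping_eqI)
    fix i
    have "Poly_Mapping.keys m \<subseteq> {1..n}" "(\<Sum>i=1..n. Poly_Mapping.lookup m i) = 0"
      using assms m unfolding hom_polys_def by blast+
    then show "Poly_Mapping.lookup m i = Poly_Mapping.lookup 0 i"
      by (cases "i \<in> {1..n}") (auto simp: in_keys_iff simp del: not_gr_zero)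
  qed
  then have "Poly_Mapping.keys f = {}" using f by (auto simp: in_keys_iff simp del: keys_eq_empty)
  then show "f = 0" by simp
qed simp

section \<open>Counting the monomials of a given degree\<close>

definition monoms :: "nat \<Rightarrow> nat \<Rightarrow> (nat \<Rightarrow>\<^sub>0 nat) set" where
  "monoms n d = {m. Poly_Mapping.keys m \<subseteq> {1..n} \<and> (\<Sum>i=1..n. Poly_Mapping.lookup m i) = d}"

text \<open>Exponents vanish outside \<open>{1..n}\<close>, so listing them there loses nothing.
  This reduces the count of monomials to stars and bars, that is, to counting lists by length and
  sum.\<close>

lemma bij_betw_monoms_lists:
  "bij_betw (\<lambda>m. map (Poly_Mapping.lookup m) [1..<Suc n]) (monoms n d)
     {l. length l = n \<and> sum_list l = d}"
  unfolding bij_betw_def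
proof
  show "inj_on (\<lambda>m. map (Poly_Mapping.lookup m) [1..<Suc n]) (monoms n d)"
  proof (rule inj_onI)
    fix m m' assume m: "m \<in> monoms n d" "m' \<in> monoms n d"
      and eq: "map (Poly_Mapping.lookup m) [1..<Suc n] = map (Poly_Mapping.lookup m') [1..<Suc n]"
    show "m = m'"
    proof (rule poly_mapping_eqI)
      fix i show "Poly_Mapping.lookup m i = Poly_Mapping.lookup m' i"
      proof (cases "i \<in> {1..n}")
        case True
        then show ?thesis using eq by (auto simp del: upt_Suc)
      next
        case False
        then have "i \<notin> Poly_Mapping.keys m" "i \<notin> Poly_Mapping.keys m'"
          using m by (auto simp: monoms_def)
        then show ?thesis by (simp add: in_keys_iff)
      qed
    qed
  qed
  have sum: "sum_list (map f [1..<Suc n]) = (\<Sum>i=1..n. f i)" for f :: "nat \<Rightarrow> nat"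
    by (simp add: sum_list_distinct_conv_sum_set atLeastLessThanSuc_atLeastAtMost del: upt_Suc)
  show "(\<lambda>m. map (Poly_Mapping.lookup m) [1..<Suc n]) ` monoms n d
      = {l. length l = n \<and> sum_list l = d}"
  proof (intro subset_antisym subsetI)
    fix l assume l: "l \<in> {l. length l = n \<and> sum_list l = d}"
    \<comment> \<open>List positions start at 0 and variables at 1, hence the shift. The support is
      finite, so \<open>Abs_poly_mapping\<close> really has these values.\<close>
    define m where "m = Abs_poly_mapping (\<lambda>i. if i \<in> {1..n} then l ! (i - 1) else 0)"
    have "finite {i. (if i \<in> {1..n} then l ! (i - 1) else 0) \<noteq> 0}"
      by (rule finite_subset[of _ "{1..n}"]) auto
    then have lookup: "Poly_Mapping.lookup m i = (if i \<in> {1..n} then l ! (i - 1) else 0)" for i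
      by (simp add: m_def lookup_Abs_poly_mapping)
    have map: "map (Poly_Mapping.lookup m) [1..<Suc n] = l"
      using l by (intro nth_equalityI) (auto simp: lookup simp del: upt_Suc)
    have "(\<Sum>i=1..n. Poly_Mapping.lookup m i) = d"
      unfolding sum[symmetric] map using l by simp
    moreover have "Poly_Mapping.keys m \<subseteq> {1..n}"
      by (auto simp: in_keys_iff lookup split: if_splits)
    ultimately have "m \<in> monoms n d" by (simp add: monoms_def)
    with map[symmetric] show "l \<in> (\<lambda>m. map (Poly_Mapping.lookup m) [1..<Suc n]) ` monoms n d"
      by (rule image_eqI)
  next
    fix l assume "l \<in> (\<lambda>m. map (Poly_Mapping.lookup m) [1..<Suc n]) ` monoms n d"
    then obtain m where "m \<in> monoms n d" "l = map (Poly_Mapping.lookup m) [1..<Suc n]" by blast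
    then show "l \<in> {l. length l = n \<and> sum_list l = d}"
      using sum[of "Poly_Mapping.lookup m"] by (simp add: monoms_def del: upt_Suc)
  qed
qed

lemma finite_lists_sum_list: "finite {l :: nat list. length l = n \<and> sum_list l = d}"
proof (rule finite_subset)
  show "{l. length l = n \<and> sum_list l = d} \<subseteq> {l. set l \<subseteq> {..d} \<and> length l = n}"
    by (auto intro: member_le_sum_list)
qed (simp add: finite_lists_length_eq)

lemma finite_monoms: "finite (monoms n d)"
  using bij_betw_monoms_lists finite_lists_sum_list bij_betw_finite by blast

lemma card_monoms: "card (monoms n d) = (n + d - 1) choose d"
  using bij_betw_same_card[OF bij_betw_monoms_lists] card_length_sum_list[of n d]
  by (simp add: add.commute)

section \<open>Forms over the base field as a vector space\<close>

lemma field_hom_zero: "field_hom \<phi> \<Longrightarrow> \<phi> 0 = 0"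
  unfolding field_hom_def by (metis add_cancel_right_right)

lemma subspace_hom_polys:
  assumes "field_hom \<iota>"
  shows "module.subspace (poly_scale \<iota>) (hom_polys n d (range \<iota>))"
proof -
  interpret vector_space "poly_scale \<iota>" using assms by (rule vector_space_poly_scale)
  have r: "\<iota> a + \<iota> b \<in> range \<iota>" "\<iota> a * \<iota> b \<in> range \<iota>" "0 \<in> range \<iota>" for a b
    using assms field_hom_zero[OF assms] unfolding field_hom_def by (metis rangeI)+
  have eq: "f \<in> hom_polys n d (range \<iota>)
      \<longleftrightarrow> f \<in> hom_polys n d UNIV \<and> (\<forall>m. Poly_Mapping.lookup f m \<in> range \<iota>)" for f
    by (auto simp: hom_polys_def)
  have "x + y \<in> range \<iota>" if "x \<in> range \<iota>" "y \<in> range \<iota>" for x y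
    using that r by auto
  moreover have "\<iota> a * x \<in> range \<iota>" if "x \<in> range \<iota>" for x a
    using that r by auto
  ultimately show ?thesis
    by (intro subspaceI; unfold eq)
      (auto simp: zero_in_hom_polys add_in_hom_polys poly_scale_def const_poly_mult_in_hom_polys
        lookup_add r(3))
qed

text \<open>The monomials with coefficient 1 form a basis over the base field: coefficients in
  \<open>range \<iota>\<close> pull back to scalars, which gives spanning, and comparing
  coefficients gives independence.\<close>

lemma
  fixes \<iota> :: "'f::field \<Rightarrow> 'l::field"
  assumes "field_hom \<iota>"
  shows hom_polys_subset_span_monoms: "hom_polys n d (range \<iota>)
      \<subseteq> module.span (poly_scale \<iota>) ((\<lambda>m. Poly_Mapping.single m 1) ` monoms n d)"
    and dim_hom_polys:
      "vector_space.dim (poly_scale \<iota>) (hom_polys n d (range \<iota>)) = (n + d - 1) choose d"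
proof -
  interpret vector_space "poly_scale \<iota>" using assms by (rule vector_space_poly_scale)
  let ?e = "\<lambda>m :: nat \<Rightarrow>\<^sub>0 nat. Poly_Mapping.single m (1 :: 'l)"
  let ?B = "?e ` monoms n d"
  have inj: "inj ?e"
    by (rule injI) (metis keys_single one_neq_zero singleton_inject)
  have e: "poly_scale \<iota> a (?e m) = Poly_Mapping.single m (\<iota> a)" for a m
    by (simp add: poly_scale_def const_poly_def mult_single)
  show span: "hom_polys n d (range \<iota>) \<subseteq> span ?B"
  proof
    fix f assume f: "f \<in> hom_polys n d (range \<iota>)"
    then have "\<forall>m. \<exists>a. Poly_Mapping.lookup f m = \<iota> a" by (auto simp: hom_polys_def)
    then obtain a where a: "\<And>m. Poly_Mapping.lookup f m = \<iota> (a m)" by metis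
    have "f = (\<Sum>m\<in>Poly_Mapping.keys f. poly_scale \<iota> (a m) (?e m))"
      by (intro poly_mapping_eqI)
        (simp add: e a[symmetric] lookup_sum lookup_single when_def sum.delta in_keys_iff)
    also have "\<dots> \<in> span ?B"
      using f by (intro span_sum span_scale span_base) (auto simp: hom_polys_def monoms_def)
    finally show "f \<in> span ?B" .
  qed
  have "independent ?B"
  proof (rule independent_if_scalars_zero)
    fix u x assume s: "(\<Sum>x\<in>?B. poly_scale \<iota> (u x) x) = 0" and "x \<in> ?B"
    then obtain m where m: "m \<in> monoms n d" "x = ?e m" by auto
    have "(\<Sum>x\<in>?B. poly_scale \<iota> (u x) x) = (\<Sum>k\<in>monoms n d. Poly_Mapping.single k (\<iota> (u (?e k))))"
      by (subst sum.reindex) (auto simp: e intro: inj_on_subset[OF inj])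
    then have "0 = Poly_Mapping.lookup (\<Sum>k\<in>monoms n d. Poly_Mapping.single k (\<iota> (u (?e k)))) m"
      using s by simp
    also have "\<dots> = \<iota> (u x)"
      using m by (simp add: lookup_sum lookup_single when_def finite_monoms)
    finally have "\<iota> (u x) = 0" by simp
    \<comment> \<open>A field homomorphism is injective, because it sends nonzero elements to
      invertible ones.\<close>
    show "u x = 0"
    proof (rule ccontr)
      assume "u x \<noteq> 0"
      then have "\<iota> (u x) * \<iota> (inverse (u x)) = 1"
        using assms unfolding field_hom_def by (metis right_inverse)
      with \<open>\<iota> (u x) = 0\<close> show False by simp
    qed
  qed (simp add: finite_monoms)
  moreover have "?B \<subseteq> hom_polys n d (range \<iota>)"
    using assms field_hom_zero[OF assms]
    by (auto simp: hom_polys_def monoms_def lookup_single when_def field_hom_def)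
  ultimately have "card ?B = dim (hom_polys n d (range \<iota>))"
    using span by (intro basis_card_eq_dim) auto
  then show "dim (hom_polys n d (range \<iota>)) = (n + d - 1) choose d"
    using card_image[OF inj_on_subset[OF inj]] card_monoms by simp
qed

section \<open>Counting products of values chosen from a finite range\<close>

lemma
  fixes g :: "nat \<Rightarrow> 'a::comm_monoid_mult" and A :: "'b set" and k :: nat
  assumes "finite A"
  defines "P \<equiv> {\<Prod>j\<in>A. g (r j) | r. \<forall>j\<in>A. r j < k}"
  shows finite_prods_of_values: "finite P"
    and card_prods_of_values_le: "card P \<le> (card A + k - 1) choose card A"
proof -
  let ?L = "{l. length l = k \<and> sum_list l = card A}"
  \<comment> \<open>Here \<open>l ! i\<close> is the number of indices \<open>j\<close> with
    \<open>r j = i\<close>. By commutativity these multiplicities determine the product, and they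
    sum to \<open>card A\<close>.\<close>
  let ?h = "\<lambda>l. \<Prod>i<k. g i ^ (l ! i)"
  have sub: "P \<subseteq> ?h ` ?L"
  proof
    fix x assume "x \<in> P"
    then obtain r where x: "x = (\<Prod>j\<in>A. g (r j))" and r: "r ` A \<subseteq> {..<k}"
      by (auto simp: P_def)
    define l where "l = map (\<lambda>i. card {j \<in> A. r j = i}) [0..<k]"
    have "x = (\<Prod>i<k. \<Prod>j\<in>{j \<in> A. r j = i}. g (r j))"
      unfolding x using assms(1) r by (intro prod.group[symmetric]) auto
    also have "\<dots> = ?h l" by (intro prod.cong) (auto simp: l_def)
    finally have "x = ?h l" .
    moreover have "sum_list l = (\<Sum>i<k. \<Sum>j\<in>{j \<in> A. r j = i}. 1)"
      by (simp add: l_def sum_list_distinct_conv_sum_set atLeast0LessThan)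
    then have "sum_list l = card A"
      using sum.group[OF assms(1) _ r, of "\<lambda>_. 1 :: nat"] by simp
    moreover have "length l = k" by (simp add: l_def)
    ultimately show "x \<in> ?h ` ?L" by blast
  qed
  have fin: "finite ?L" by (rule finite_lists_sum_list)
  show "finite P" using sub fin by (meson finite_imageI finite_subset)
  \<comment> \<open>Different multiplicities may give equal products, so this is only an
    inequality.\<close>
  have "card P \<le> card ?L" using sub fin by (meson card_image_le card_mono finite_imageI le_trans)
  then show "card P \<le> (card A + k - 1) choose card A" by (simp add: card_length_sum_list)
qed

section \<open>From equations in the extension field to linear conditions over the base
  field\<close>

lemma linear_coordinate_diff_act:
  fixes \<iota> :: "'f::field \<Rightarrow> 'l::field"
  assumes \<iota>: "field_hom \<iota>" and B: "\<not> module.dependent (ext_scale \<iota>) B"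
    "module.span (ext_scale \<iota>) B = UNIV"
  shows "Vector_Spaces.linear (poly_scale \<iota>) (*)
    (\<lambda>f. module.representation (ext_scale \<iota>) B (Poly_Mapping.lookup (diff_act D f) m) b)"
proof -
  interpret L: vector_space "ext_scale \<iota>" using \<iota> by (rule vector_space_ext_scale)
  \<comment> \<open>Multiplication by \<open>\<iota> c\<close> is the scalar action of
    \<open>c\<close> on the extension field, so coordinates with respect to \<open>B\<close> scale
    by \<open>c\<close> itself.\<close>
  have add: "L.representation B (x + y) b = L.representation B x b + L.representation B y b"
    and scale: "L.representation B (\<iota> c * x) b = c * L.representation B x b" for x y c
    using B L.representation_scale[of B x c]
    by (simp_all add: L.representation_add ext_scale_def[of \<iota> c x, symmetric])
  show ?thesis
    unfolding Vector_Spaces.linear_iff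
  proof (intro conjI allI)
    show "vector_space (poly_scale \<iota>)" using \<iota> by (rule vector_space_poly_scale)
    show "vector_space ((*) :: 'f \<Rightarrow> 'f \<Rightarrow> 'f)" by unfold_locales (auto simp: algebra_simps)
  qed (simp_all add: poly_scale_def diff_act_add diff_act_const_poly_mult lookup_add add scale)
qed

theorem proposition3p7:
  fixes \<iota> :: "'f::field \<Rightarrow> 'l::field"
    and \<sigma> :: "'l \<Rightarrow> 'l"
    and \<alpha> :: "nat \<Rightarrow> 'l"
    and n d \<rho> :: nat
  assumes "d \<ge> 2" and "n \<ge> 1" and "1 \<le> \<rho>" and "\<rho> \<le> n"
    and "galois_extension \<iota>" and "ext_degree \<iota> = n"
    and "\<sigma> \<in> carrier (Gal \<iota>)" and "generate (Gal \<iota>) {\<sigma>} = carrier (Gal \<iota>)"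
    and "ext_basis \<iota> n \<alpha>"
  shows "int (vector_space.dim (poly_scale \<iota>) (code_space \<iota> \<sigma> n d \<rho> \<alpha>))
           \<ge> int ((n + d - 1) choose d) - int n * int ((d + \<rho> - 3) choose (d - 1))"
proof -
  have \<iota>: "field_hom \<iota>"
    using \<open>galois_extension \<iota>\<close> by (simp add: galois_extension_def finite_extension_def)
  interpret L: vector_space "ext_scale \<iota>" using \<iota> by (rule vector_space_ext_scale)
  interpret P: vector_space "poly_scale \<iota>" using \<iota> by (rule vector_space_poly_scale)
  \<comment> \<open>The entries of \<open>\<alpha>\<close> also serve as the basis in which the
    values of the operators are written; there are \<open>n\<close> of them as
    \<open>\<alpha>\<close> is injective on \<open>{1..n}\<close>.\<close>
  define B where "B = \<alpha> ` {1..n}"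
  have B: "L.independent B" "L.span B = UNIV" "card B = n" "finite B"
    using \<open>ext_basis \<iota> n \<alpha>\<close> by (auto simp: ext_basis_def B_def card_image)
  let ?V = "hom_polys n d (range \<iota>)"
  let ?g = "\<lambda>k. dir_op n (\<lambda>i. (\<sigma> ^^ k) (\<alpha> i))"
  \<comment> \<open>The common factor \<open>dir_op n \<alpha>\<close> is split off, which leaves
    \<open>d - 1\<close> factors with \<open>\<rho> - 1\<close> choices each. For
    \<open>\<rho> = 1\<close> there is no choice, \<open>Q\<close> is empty and the binomial
    coefficient below is 0.\<close>
  define Q where "Q = {\<Prod>j\<in>{2..d}. ?g (r j) | r. \<forall>j\<in>{2..d}. r j < \<rho> - 1}"
  define \<D> where "\<D> = (\<lambda>q. dir_op n \<alpha> * q) ` Q"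
  have Q: "finite Q" "card Q \<le> (d + \<rho> - 3) choose (d - 1)"
  proof -
    show "finite Q" unfolding Q_def by (rule finite_prods_of_values) simp
    have "card Q \<le> (card {2..d} + (\<rho> - 1) - 1) choose card {2..d}"
      unfolding Q_def by (rule card_prods_of_values_le) simp
    moreover have "card {2..d} = d - 1" "card {2..d} + (\<rho> - 1) - 1 = d + \<rho> - 3"
      using assms(1,3) by auto
    ultimately show "card Q \<le> (d + \<rho> - 3) choose (d - 1)" by simp
  qed
  have \<D>_hom: "D \<in> hom_polys n d UNIV" if D_in: "D \<in> \<D>" for D
  proof -
    obtain r where D: "D = dir_op n \<alpha> * (\<Prod>j\<in>{2..d}. ?g (r j))"
      using D_in by (auto simp: \<D>_def Q_def)
    have "(\<Prod>j\<in>{2..d}. ?g (r j)) \<in> hom_polys n (card {2..d}) UNIV"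
      by (intro prod_in_hom_polys dir_op_in_hom_polys) auto
    from mult_in_hom_polys[OF dir_op_in_hom_polys[of n \<alpha>] this] show ?thesis
      using assms(1) by (simp add: D)
  qed
  \<comment> \<open>Each operator contributes one functional for each basis element
    \<open>b\<close>: the \<open>b\<close>-coordinate of the constant term of its value.\<close>
  define J where "J = \<D> \<times> B"
  define \<phi> where "\<phi> = (\<lambda>(D, b) f. L.representation B (Poly_Mapping.lookup (diff_act D f) 0) b)"
  have vanish: "diff_act D f = 0 \<longleftrightarrow> (\<forall>b\<in>B. \<phi> (D, b) f = 0)" if "D \<in> \<D>" "f \<in> ?V" for D f
  proof -
    let ?c = "Poly_Mapping.lookup (diff_act D f) 0"
    have "f \<in> hom_polys n d UNIV" using that(2) by (auto simp: hom_polys_def)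
    then have "diff_act D f \<in> hom_polys n 0 UNIV"
      using \<D>_hom[OF that(1)] by (intro diff_act_in_hom_polys[of D n d]) auto
    then have "diff_act D f = 0 \<longleftrightarrow> ?c = 0" by (rule hom_polys_0_eq_0_iff)
    also have "\<dots> \<longleftrightarrow> (\<forall>b\<in>B. L.representation B ?c b = 0)"
    proof
      assume "\<forall>b\<in>B. L.representation B ?c b = 0"
      moreover have "(\<Sum>b\<in>B. ext_scale \<iota> (L.representation B ?c b) b) = ?c"
        using B by (intro L.sum_representation_eq) auto
      ultimately show "?c = 0" by simp
    qed (simp add: L.representation_zero)
    finally show ?thesis by (simp add: \<phi>_def)
  qed
  \<comment> \<open>Truncation is harmless: for \<open>\<rho> = 1\<close> neither side holds for any
    \<open>k\<close>.\<close>
  have admissible: "int k \<le> int \<rho> - 2 \<longleftrightarrow> k < \<rho> - 1" for k by auto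
  have "{dir_op n \<alpha> * (\<Prod>j=2..d. ?g (r j)) | r. \<forall>j\<in>{2..d}. int (r j) \<le> int \<rho> - 2} = \<D>"
    unfolding \<D>_def Q_def admissible by blast
  \<comment> \<open>Intersecting with the forms over \<open>range \<iota>\<close> turns the ambient
    space of \<open>perp\<close> into \<open>?V\<close>.\<close>
  then have "code_space \<iota> \<sigma> n d \<rho> \<alpha> = {f \<in> ?V. \<forall>D\<in>\<D>. diff_act D f = 0}"
    unfolding code_space_def perp_def by (auto simp: hom_polys_def)
  also have "\<dots> = {f \<in> ?V. \<forall>j\<in>J. \<phi> j f = 0}"
    unfolding J_def using vanish by auto
  finally have code: "code_space \<iota> \<sigma> n d \<rho> \<alpha> = {f \<in> ?V. \<forall>j\<in>J. \<phi> j f = 0}" .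
  have "P.dim ?V \<le> P.dim {f \<in> ?V. \<forall>j\<in>J. \<phi> j f = 0} + card J"
  proof (rule P.dim_le_dim_kernels_add_card)
    show "P.subspace ?V" using \<iota> by (rule subspace_hom_polys)
    show "?V \<subseteq> P.span ((\<lambda>m. Poly_Mapping.single m 1) ` monoms n d)"
      using \<iota> by (rule hom_polys_subset_span_monoms)
    show "finite J" using Q B by (simp add: J_def \<D>_def)
    show "Vector_Spaces.linear (poly_scale \<iota>) (*) (\<phi> j)" if "j \<in> J" for j
      using linear_coordinate_diff_act[OF \<iota> B(1,2)] by (simp add: \<phi>_def split: prod.split)
  qed (simp add: finite_monoms)
  \<comment> \<open>Multiplication by \<open>dir_op n \<alpha>\<close> maps \<open>Q\<close> onto
    \<open>\<D>\<close>, so there are at most \<open>card Q\<close> operators, with \<open>n\<close>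
    coordinates each.\<close>
  moreover have "card J \<le> n * ((d + \<rho> - 3) choose (d - 1))"
    using Q B card_image_le[OF Q(1), of "\<lambda>q. dir_op n \<alpha> * q"]
    by (simp add: J_def \<D>_def card_cartesian_product mult.commute)
  ultimately have "(n + d - 1) choose d
      \<le> P.dim (code_space \<iota> \<sigma> n d \<rho> \<alpha>) + n * ((d + \<rho> - 3) choose (d - 1))"
    by (simp add: code dim_hom_polys[OF \<iota>])
  \<comment> \<open>The bound may be negative, so the subtraction is carried out only after the
    passage from naturals to integers.\<close>
  then show ?thesis by (simp add: of_nat_mult[symmetric] of_nat_add[symmetric] del: of_nat_mult of_nat_add)
qed

end
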